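(* Consider an instance of the Lovász Local Lemma in which every random variable affects at most $2$ bad events, and which satisfies the criterion $p < 2^{-d}$. Then there is a sequential and local deterministic process that computes an assignment to the random variables under which none of the bad events occurs.
   Context: An instance of the (symmetric) Lovász Local Lemma (LLL) consists of a finite set of mutually independent random variables $X_1,\dots,X_m$, each with a finite discrete range, and a finite set of "bad" events $\mathcal{E}_1,\dots,\mathcal{E}_n$, each determined by the values of some subset of the variables; a variable affects an event if the event depends on it. The dependency graph has the events as nodes, two events being adjacent iff they depend on a common variable; $d$ denotes its maximum degree, and $p$ is an upper bound on $\Pr[\mathcal{E}_i]$ for all $i$. The process fixes the random variables one at a time to concrete values (a fixed value is never changed), in an arbitrary (even adversarially chosen) order; "local" means the value chosen for a variable depends only on the values already assigned to variables affecting the same events as that variable, so that variables affecting disjoint sets of events can be fixed in parallel. *)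

theory Defs
  imports "HOL-Probability.Probability"
begin

text \<open>
  A bad event is given by the set of complete assignments (with values in the ranges of the
  variables) under which it occurs. Values in a range may have probability zero.
\<close>

record ('w, 'v, 'a, 'e) lll =
  sample :: "'w measure"
  vars :: "'v set"
  rng :: "'v \<Rightarrow> 'a set"
  rv :: "'v \<Rightarrow> 'w \<Rightarrow> 'a"
  events :: "'e set"
  bad :: "'e \<Rightarrow> ('v \<Rightarrow> 'a) set"

definition assignments :: "('w, 'v, 'a, 'e) lll \<Rightarrow> ('v \<Rightarrow> 'a) set" where
  "assignments I = PiE (vars I) (rng I)"

definition lll_instance :: "('w, 'v, 'a, 'e) lll \<Rightarrow> bool" where
  "lll_instance I \<longleftrightarrow>
     prob_space (sample I) \<and>
     finite (vars I) \<and> (\<forall>x \<in> vars I. finite (rng I x)) \<and>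
     prob_space.indep_vars (sample I) (\<lambda>x. count_space (rng I x)) (rv I) (vars I) \<and>
     finite (events I) \<and> (\<forall>i \<in> events I. bad I i \<subseteq> assignments I)"

definition event_prob :: "('w, 'v, 'a, 'e) lll \<Rightarrow> 'e \<Rightarrow> real" where
  "event_prob I i =
     measure (sample I) {w \<in> space (sample I). (\<lambda>x \<in> vars I. rv I x w) \<in> bad I i}"

definition affects :: "('w, 'v, 'a, 'e) lll \<Rightarrow> 'v \<Rightarrow> 'e \<Rightarrow> bool" where
  "affects I x i \<longleftrightarrow> x \<in> vars I \<and> i \<in> events I \<and>
     (\<exists>f \<in> assignments I. \<exists>c \<in> rng I x. f \<in> bad I i \<and> f(x := c) \<notin> bad I i)"

definition affected_events :: "('w, 'v, 'a, 'e) lll \<Rightarrow> 'v \<Rightarrow> 'e set" where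
  "affected_events I x = {i. affects I x i}"

definition adjacent :: "('w, 'v, 'a, 'e) lll \<Rightarrow> 'e \<Rightarrow> 'e \<Rightarrow> bool" where
  "adjacent I i j \<longleftrightarrow> i \<noteq> j \<and> (\<exists>x. affects I x i \<and> affects I x j)"

text \<open>Inserting 0 only matters for an instance without events.\<close>

definition max_degree :: "('w, 'v, 'a, 'e) lll \<Rightarrow> nat" where
  "max_degree I = Max (insert 0 ((\<lambda>i. card {j \<in> events I. adjacent I i j}) ` events I))"

definition neighbours :: "('w, 'v, 'a, 'e) lll \<Rightarrow> 'v \<Rightarrow> 'v set" where
  "neighbours I x = {y. \<exists>i. affects I x i \<and> affects I y i}"

definition event_vars :: "('w, 'v, 'a, 'e) lll \<Rightarrow> 'e \<Rightarrow> 'v set" where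
  "event_vars I i = {x. affects I x i}"

text \<open>The event as a condition on just the variables that it depends on.\<close>

definition event_trace :: "('w, 'v, 'a, 'e) lll \<Rightarrow> 'e \<Rightarrow> ('v \<Rightarrow> 'a) set" where
  "event_trace I i = (\<lambda>f. restrict f (event_vars I i)) ` bad I i"

definition law :: "('w, 'v, 'a, 'e) lll \<Rightarrow> 'v \<Rightarrow> 'a measure" where
  "law I x = distr (sample I) (count_space (rng I x)) (rv I x)"

text \<open>
  A history is the chronological list of the variables fixed so far with their values. A process
  maps the instance, the history and the variable to be fixed next to the value of that variable.
  A process receives the instance as an argument, and its locality is required with respect to
  the instance too: if one could choose a process separately for each instance, it could
  have a solution of that instance hardwired, and locality would be void.
\<close>

type_synonym ('w, 'v, 'a, 'e) lll_process =
  "('w, 'v, 'a, 'e) lll \<Rightarrow> ('v \<times> 'a) list \<Rightarrow> 'v \<Rightarrow> 'a"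

definition local_history ::
    "('w, 'v, 'a, 'e) lll \<Rightarrow> 'v \<Rightarrow> ('v \<times> 'a) list \<Rightarrow> ('v \<times> 'a) list" where
  "local_history I x h = filter (\<lambda>(y, c). y \<in> neighbours I x) h"

text \<open>
  The variable \<open>x\<close> is listed separately in the last conjunct because it is not one of its own
  neighbours if it affects no event.
\<close>

definition same_local_instance ::
    "('w, 'v, 'a, 'e) lll \<Rightarrow> ('w, 'v, 'a, 'e) lll \<Rightarrow> 'v \<Rightarrow> bool" where
  "same_local_instance I J x \<longleftrightarrow>
     affected_events I x = affected_events J x \<and>
     (\<forall>i \<in> affected_events I x.
        event_vars I i = event_vars J i \<and> event_trace I i = event_trace J i) \<and>
     (\<forall>y \<in> insert x (neighbours I x). rng I y = rng J y \<and> law I y = law J y)"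

definition local_process :: "('w, 'v, 'a, 'e) lll_process \<Rightarrow> bool" where
  "local_process \<sigma> \<longleftrightarrow>
     (\<forall>I J x h k.
        lll_instance I \<and> lll_instance J \<and> x \<in> vars I \<and> x \<in> vars J \<and>
        same_local_instance I J x \<and> local_history I x h = local_history J x k
        \<longrightarrow> \<sigma> I h x = \<sigma> J k x)"

definition run ::
    "('w, 'v, 'a, 'e) lll_process \<Rightarrow> ('w, 'v, 'a, 'e) lll \<Rightarrow> 'v list \<Rightarrow> ('v \<times> 'a) list" where
  "run \<sigma> I xs = foldl (\<lambda>h x. h @ [(x, \<sigma> I h x)]) [] xs"

definition outcome ::
    "('w, 'v, 'a, 'e) lll_process \<Rightarrow> ('w, 'v, 'a, 'e) lll \<Rightarrow> 'v list \<Rightarrow> 'v \<Rightarrow> 'a" where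
  "outcome \<sigma> I xs = (\<lambda>x \<in> vars I. the (map_of (run \<sigma> I xs) x))"

text \<open>
  Quantifying over all orders also covers orders chosen adaptively by an adversary: the process is
  deterministic and sees only the past, so every adaptive play is the run on some list.
\<close>

definition solves :: "('w, 'v, 'a, 'e) lll_process \<Rightarrow> ('w, 'v, 'a, 'e) lll \<Rightarrow> bool" where
  "solves \<sigma> I \<longleftrightarrow>
     (\<forall>xs. distinct xs \<and> set xs = vars I \<longrightarrow>
        outcome \<sigma> I xs \<in> assignments I \<and> (\<forall>i \<in> events I. outcome \<sigma> I xs \<notin> bad I i))"

end

theory Submission
  imports Defs
begin

text \<open>
  Keep, for each event \<open>i\<close>, its probability given the values fixed so far. Fixing a variable
  multiplies this probability by a factor whose mean over the law of the variable is at most 1. For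
  adjacent events \<open>i\<close> and \<open>j\<close>, let the share of \<open>i\<close> towards \<open>j\<close> be the product of the factors
  for \<open>i\<close> caused by the variables that affect both. The process picks a value for which the
  sum of the two shares on the pair does not grow. So this sum stays at most 2, each
  share stays at most 2, and the probability of \<open>i\<close> stays at most \<open>p * 2 ^ d < 1\<close>. Once all
  variables are fixed, an event that occurs would have probability 1. The shares at a variable
  depend on the values of its neighbours only, whence locality.
\<close>

section \<open>The process: probabilities under a history, shares, choice of a value\<close>

definition value_prob :: "('w, 'v, 'a, 'e) lll \<Rightarrow> ('v \<times> 'a) list \<Rightarrow> 'v \<Rightarrow> 'a \<Rightarrow> real" where
  "value_prob I h y a =
     (case map_of h y of None \<Rightarrow> measure (law I y) {a} | Some c \<Rightarrow> of_bool (a = c))"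

text \<open>Unlike a true conditional probability, this is meaningful even if \<open>h\<close> has probability zero.\<close>

definition fixed_prob :: "('w, 'v, 'a, 'e) lll \<Rightarrow> ('v \<times> 'a) list \<Rightarrow> 'e \<Rightarrow> real" where
  "fixed_prob I h i = (\<Sum>g\<in>event_trace I i. \<Prod>y\<in>event_vars I i. value_prob I h y (g y))"

text \<open>Each factor is evaluated on the prefix of the history at which its variable was fixed.
  The share is directed: only changes of \<open>i\<close> enter. For the empty history it is 1, so
  the two shares of a pair start with sum 2. A factor with denominator 0 counts as 0.\<close>

definition share :: "('w, 'v, 'a, 'e) lll \<Rightarrow> ('v \<times> 'a) list \<Rightarrow> 'e \<Rightarrow> 'e \<Rightarrow> real" where
  "share I h i j =
     (\<Prod>k<length h. if fst (h ! k) \<in> event_vars I i \<inter> event_vars I j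
        then fixed_prob I (take (Suc k) h) i / fixed_prob I (take k h) i else 1)"

text \<open>
  The product has no factor if \<open>x\<close> affects one event and a single one if it affects two.
\<close>

definition pair_share :: "('w, 'v, 'a, 'e) lll \<Rightarrow> ('v \<times> 'a) list \<Rightarrow> 'v \<Rightarrow> 'e \<Rightarrow> real" where
  "pair_share I h x i = (\<Prod>j\<in>affected_events I x - {i}. share I h i j)"

text \<open>
  Positive probability of \<open>c\<close> is demanded because a value of probability zero could make
  the probability of an event jump from 0 to a positive number, where the quotient is 0.
\<close>

definition good_value ::
    "('w, 'v, 'a, 'e) lll \<Rightarrow> ('v \<times> 'a) list \<Rightarrow> 'v \<Rightarrow> 'a \<Rightarrow> bool" where
  "good_value I h x c \<longleftrightarrow> c \<in> rng I x \<and> 0 < measure (law I x) {c} \<and>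
     (\<Sum>i\<in>affected_events I x.
        pair_share I h x i * (fixed_prob I (h @ [(x, c)]) i / fixed_prob I h i))
     \<le> (\<Sum>i\<in>affected_events I x. pair_share I h x i)"

text \<open>\<open>SOME\<close> depends on nothing but the predicate
  \<open>good_value I h x\<close>, so locality reduces to an equality of such predicates.\<close>

definition share_process :: "('w, 'v, 'a, 'e) lll_process" where
  "share_process I h x = (SOME c. good_value I h x c)"

section \<open>Locality\<close>

lemma fixed_prob_cong:
  assumes "event_vars I i = event_vars J i" "event_trace I i = event_trace J i"
    and "\<And>y. y \<in> event_vars I i \<Longrightarrow> law I y = law J y"
    and "\<And>y. y \<in> event_vars I i \<Longrightarrow> map_of h y = map_of k y"
  shows "fixed_prob I h i = fixed_prob J k i"
  using assms by (auto simp: fixed_prob_def value_prob_def intro!: sum.cong prod.cong split: option.split)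

lemma share_snoc:
  "share I (h @ [(x, c)]) i j = share I h i j *
     (if x \<in> event_vars I i \<inter> event_vars I j
      then fixed_prob I (h @ [(x, c)]) i / fixed_prob I h i else 1)"
proof -
  have "(\<Prod>k<length h. if fst ((h @ [(x, c)]) ! k) \<in> event_vars I i \<inter> event_vars I j
      then fixed_prob I (take (Suc k) (h @ [(x, c)])) i / fixed_prob I (take k (h @ [(x, c)])) i
      else 1) = share I h i j"
    unfolding share_def by (intro prod.cong) (auto simp: nth_append)
  then show ?thesis
    unfolding share_def[of I "h @ _"] by simp
qed

lemma map_of_filter_key:
  "y \<in> S \<Longrightarrow> map_of (filter (\<lambda>(y, c). y \<in> S) h) y = map_of h y"
  by (induction h) auto

lemma fixed_prob_filter:
  assumes "event_vars I i \<subseteq> S"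
  shows "fixed_prob I (filter (\<lambda>(y, c). y \<in> S) h) i = fixed_prob I h i"
  using assms by (intro fixed_prob_cong) (auto simp: map_of_filter_key)

text \<open>An entry outside \<open>S\<close> fixes a variable on which \<open>i\<close> does not
  depend, so its factor is 1. Dropping it leaves all probabilities of \<open>i\<close> in the other
  factors unchanged.\<close>

lemma share_filter:
  assumes "event_vars I i \<subseteq> S"
  shows "share I (filter (\<lambda>(y, c). y \<in> S) h) i j = share I h i j"
proof (induction h rule: rev_induct)
  case (snoc z h)
  obtain x c where z: "z = (x, c)" by (cases z)
  show ?case
  proof (cases "x \<in> S")
    case True
    then have "filter (\<lambda>(y, c). y \<in> S) (h @ [z]) = filter (\<lambda>(y, c). y \<in> S) h @ [(x, c)]"
      by (simp add: z)
    moreover from this have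
      "fixed_prob I (filter (\<lambda>(y, c). y \<in> S) h @ [(x, c)]) i = fixed_prob I (h @ [(x, c)]) i"
      using fixed_prob_filter[OF assms, of "h @ [z]"] z by simp
    ultimately show ?thesis
      by (simp add: z share_snoc snoc fixed_prob_filter[OF assms])
  next
    case False
    then have "x \<notin> event_vars I i" using assms by auto
    then show ?thesis
      using False by (simp add: z share_snoc snoc)
  qed
qed simp

lemma share_cong:
  assumes "event_vars I i = event_vars J i" "event_trace I i = event_trace J i"
    and "\<And>y. y \<in> event_vars I i \<Longrightarrow> law I y = law J y"
    and "event_vars I j = event_vars J j"
  shows "share I h i j = share J h i j"
proof -
  have "fixed_prob I l i = fixed_prob J l i" for l
    using assms by (intro fixed_prob_cong) auto
  then show ?thesis
    unfolding share_def by (simp add: assms cong: if_cong)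
qed

lemma neighbours_eq: "neighbours I x = (\<Union>i\<in>affected_events I x. event_vars I i)"
  by (auto simp: neighbours_def affected_events_def event_vars_def)

text \<open>Apart from the range and law of \<open>x\<close>, the criterion evaluates only events
  affected by \<open>x\<close>, and all variables of these events are neighbours of
  \<open>x\<close>. So it sees only data on which the two instances and histories agree.\<close>

lemma good_value_local:
  assumes same: "same_local_instance I J x"
    and hist: "local_history I x h = local_history J x k"
  shows "good_value I h x = good_value J k x"
proof
  fix c
  have A: "affected_events I x = affected_events J x"
    and V: "\<And>i. i \<in> affected_events I x \<Longrightarrow> event_vars I i = event_vars J i"
    and T: "\<And>i. i \<in> affected_events I x \<Longrightarrow> event_trace I i = event_trace J i"
    and L: "\<And>y. y \<in> insert x (neighbours I x) \<Longrightarrow> law I y = law J y"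
    and R: "rng I x = rng J x"
    using same by (auto simp: same_local_instance_def)
  define N where "N = neighbours I x"
  have NJ: "neighbours J x = N"
    unfolding N_def neighbours_eq using A V by auto
  have VN: "event_vars I i \<subseteq> N" if "i \<in> affected_events I x" for i
    using that by (auto simp: N_def neighbours_eq)
  have LV: "law I y = law J y" if "i \<in> affected_events I x" "y \<in> event_vars I i" for i y
    using L VN that by (auto simp: N_def)
  have hk: "filter (\<lambda>(y, c). y \<in> N) h = filter (\<lambda>(y, c). y \<in> N) k"
    using hist by (simp add: local_history_def NJ N_def)
  have m: "map_of h y = map_of k y" if "y \<in> N" for y
    using map_of_filter_key[OF that, of h] map_of_filter_key[OF that, of k] hk by simp
  have P: "fixed_prob I h i = fixed_prob J k i"
    "fixed_prob I (h @ [(x, c)]) i = fixed_prob J (k @ [(x, c)]) i"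
    if "i \<in> affected_events I x" for i
    using that V T LV VN m by (intro fixed_prob_cong; force simp: map_add_def)+
  have S: "share I h i j = share J k i j"
    if ij: "i \<in> affected_events I x" "j \<in> affected_events I x" for i j
  proof -
    \<comment> \<open>The full histories may differ in length, so their products cannot be matched
      index by index. Both are compared with their common restriction to \<open>N\<close>.\<close>
    have "share I h i j = share I (filter (\<lambda>(y, c). y \<in> N) h) i j"
      using share_filter[OF VN[OF ij(1)]] by simp
    also have "\<dots> = share J (filter (\<lambda>(y, c). y \<in> N) k) i j"
      unfolding hk using ij V T LV by (intro share_cong) auto
    also have "\<dots> = share J k i j"
      using VN[OF ij(1)] V[OF ij(1)] by (intro share_filter) auto
    finally show ?thesis .
  qed
  have Q: "pair_share I h x i = pair_share J k x i" if "i \<in> affected_events I x" for i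
    unfolding pair_share_def using S that A by (intro prod.cong) auto
  show "good_value I h x c = good_value J k x c"
    unfolding good_value_def using A R L P Q by simp
qed

lemma local_share_process: "local_process share_process"
  unfolding local_process_def share_process_def using good_value_local by metis

section \<open>Events as conditions on their own variables\<close>

locale lll_inst =
  fixes I :: "('w, 'v, 'a, 'e) lll"
  assumes inst: "lll_instance I"
begin

sublocale prob_space "sample I"
  using inst by (simp add: lll_instance_def)

lemma finite_vars: "finite (vars I)"
  and finite_rng: "x \<in> vars I \<Longrightarrow> finite (rng I x)"
  and indep: "indep_vars (\<lambda>x. count_space (rng I x)) (rv I) (vars I)"
  and finite_events: "finite (lll.events I)"
  and bad_subset: "i \<in> lll.events I \<Longrightarrow> bad I i \<subseteq> assignments I"
  using inst by (auto simp: lll_instance_def)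

lemma rv_measurable [measurable]:
  "x \<in> vars I \<Longrightarrow> rv I x \<in> sample I \<rightarrow>\<^sub>M count_space (rng I x)"
  using indep by (simp add: indep_vars_def)

lemma rv_in_rng: "x \<in> vars I \<Longrightarrow> w \<in> space (sample I) \<Longrightarrow> rv I x w \<in> rng I x"
  using measurable_space[OF rv_measurable] by simp

lemma law_singleton:
  assumes "x \<in> vars I" "c \<in> rng I x"
  shows "measure (law I x) {c} = prob {w \<in> space (sample I). rv I x w = c}"
proof -
  have "rv I x -` {c} \<inter> space (sample I) = {w \<in> space (sample I). rv I x w = c}"
    by auto
  then show ?thesis
    using assms by (simp add: law_def measure_distr)
qed

lemma sum_law:
  assumes "x \<in> vars I"
  shows "(\<Sum>c\<in>rng I x. measure (law I x) {c}) = 1"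
proof -
  interpret L: prob_space "law I x"
    unfolding law_def using assms by (intro prob_space_distr rv_measurable)
  have "measure (law I x) (rng I x) = (\<Sum>c\<in>rng I x. measure (law I x) {c})"
    using finite_rng[OF assms] by (intro L.finite_measure_eq_sum_singleton) (auto simp: law_def)
  moreover have "space (law I x) = rng I x"
    by (simp add: law_def)
  ultimately show ?thesis
    using L.prob_space by simp
qed

lemma finite_assignments: "finite (assignments I)"
  unfolding assignments_def using finite_vars finite_rng by (rule finite_PiE)

lemma event_vars_subset: "event_vars I i \<subseteq> vars I"
  by (auto simp: event_vars_def affects_def)

lemma finite_event_vars: "finite (event_vars I i)"
  using event_vars_subset finite_vars finite_subset by blast

lemma finite_event_trace: "i \<in> lll.events I \<Longrightarrow> finite (event_trace I i)"
  unfolding event_trace_def using finite_assignments bad_subset finite_subset by blast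

lemma event_trace_in_rng:
  assumes "i \<in> lll.events I" "g \<in> event_trace I i" "y \<in> event_vars I i"
  shows "g y \<in> rng I y"
  using assms bad_subset[OF assms(1)] event_vars_subset[of i]
  by (fastforce simp: event_trace_def assignments_def)

text \<open>Otherwise \<open>f\<close> and \<open>c\<close> would witness that \<open>x\<close>
  affects \<open>i\<close>.\<close>

lemma bad_upd:
  assumes "i \<in> lll.events I" "f \<in> bad I i" "x \<in> vars I" "x \<notin> event_vars I i" "c \<in> rng I x"
  shows "f(x := c) \<in> bad I i"
  using assms bad_subset[OF assms(1)] by (auto simp: event_vars_def affects_def)

text \<open>The coordinates in \<open>X\<close> are changed one at a time, and no single change
  leaves the event.\<close>

lemma bad_override_on:
  assumes i: "i \<in> lll.events I" and f: "f \<in> bad I i" and g: "g \<in> assignments I"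
    and "finite X" "X \<subseteq> vars I - event_vars I i"
  shows "override_on f g X \<in> bad I i"
  using assms(4,5)
proof (induction X)
  case (insert x X)
  have eq: "override_on f g (insert x X) = (override_on f g X)(x := g x)"
    by (auto simp: override_on_def)
  have "g x \<in> rng I x"
    using g insert.prems by (auto simp: assignments_def)
  then show ?case
    unfolding eq using insert by (intro bad_upd[OF i]) auto
qed (use f in simp)

text \<open>An \<open>f\<close> in the event with the same trace as \<open>g\<close> becomes
  \<open>g\<close> once all variables that do not affect \<open>i\<close> are overridden. Hence the
  trace determines the event.\<close>

lemma bad_iff_event_trace:
  assumes i: "i \<in> lll.events I" and g: "g \<in> assignments I"
  shows "g \<in> bad I i \<longleftrightarrow> restrict g (event_vars I i) \<in> event_trace I i"
proof
  assume "restrict g (event_vars I i) \<in> event_trace I i"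
  then obtain f where f: "f \<in> bad I i" "restrict g (event_vars I i) = restrict f (event_vars I i)"
    by (auto simp: event_trace_def)
  have "override_on f g (vars I - event_vars I i) = g"
  proof
    fix y
    show "override_on f g (vars I - event_vars I i) y = g y"
      using f(1) bad_subset[OF i] g fun_cong[OF f(2), of y]
      by (cases "y \<in> event_vars I i")
        (auto simp: override_on_def assignments_def PiE_def extensional_def)
  qed
  then show "g \<in> bad I i"
    using bad_override_on[OF i f(1) g, of "vars I - event_vars I i"] finite_vars by auto
qed (auto simp: event_trace_def)

section \<open>Independence and the initial probabilities\<close>

text \<open>Mutual independence turns the probability of prescribed values into a product over the
  variables.\<close>

lemma prob_agree:
  assumes V: "V \<subseteq> vars I" and g: "\<And>y. y \<in> V \<Longrightarrow> g y \<in> rng I y"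
  shows "{w \<in> space (sample I). \<forall>y\<in>V. rv I y w = g y} \<in> events" (is "?E \<in> _")
    and "prob {w \<in> space (sample I). \<forall>y\<in>V. rv I y w = g y} = (\<Prod>y\<in>V. measure (law I y) {g y})"
proof -
  have "?E \<in> events \<and> prob ?E = (\<Prod>y\<in>V. measure (law I y) {g y})"
  \<comment> \<open>The product rule for independent variables asks for a nonempty index set. For
    empty \<open>V\<close> the set is the whole space and the product is 1.\<close>
  proof (cases "V = {}")
    case False
    have fin: "finite V" using V finite_vars finite_subset by blast
    have E: "?E = (\<Inter>y\<in>V. rv I y -` {g y} \<inter> space (sample I))"
      using False by auto
    have m: "rv I y -` {g y} \<inter> space (sample I) \<in> events" if "y \<in> V" for y
      using V g that by (intro measurable_sets[OF rv_measurable]) auto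
    have "prob ?E = (\<Prod>y\<in>V. prob (rv I y -` {g y} \<inter> space (sample I)))"
      unfolding E using V g by (intro indep_varsD[OF indep False fin]) auto
    also have "\<dots> = (\<Prod>y\<in>V. measure (law I y) {g y})"
      using V g by (intro prod.cong) (auto simp: law_singleton Int_def conj_commute vimage_def)
    finally show ?thesis
      using sets.finite_INT[OF fin False m] unfolding E by simp
  qed (use prob_space in auto)
  then show "?E \<in> events" "prob ?E = (\<Prod>y\<in>V. measure (law I y) {g y})"
    by auto
qed

text \<open>The event splits into disjoint pieces, one for each element of its trace, and
  independence gives each piece the product weight.\<close>

lemma fixed_prob_Nil:
  assumes i: "i \<in> lll.events I"
  shows "fixed_prob I [] i = event_prob I i"
proof -
  define V where "V = event_vars I i"
  define E where "E g = {w \<in> space (sample I). \<forall>y\<in>V. rv I y w = g y}" for g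
  have V: "V \<subseteq> vars I" unfolding V_def by (rule event_vars_subset)
  have ext: "g \<in> extensional V" if "g \<in> event_trace I i" for g
    using that by (auto simp: event_trace_def V_def)
  have "{w \<in> space (sample I). (\<lambda>x\<in>vars I. rv I x w) \<in> bad I i} = (\<Union>g\<in>event_trace I i. E g)"
  proof -
    have "(\<lambda>x\<in>vars I. rv I x w) \<in> bad I i \<longleftrightarrow> (\<lambda>x\<in>V. rv I x w) \<in> event_trace I i"
      if "w \<in> space (sample I)" for w
    proof -
      have "(\<lambda>x\<in>vars I. rv I x w) \<in> assignments I"
        using that rv_in_rng by (auto simp: assignments_def)
      moreover have "restrict (\<lambda>x\<in>vars I. rv I x w) V = (\<lambda>x\<in>V. rv I x w)"
        using V by (auto simp: restrict_def fun_eq_iff)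
      ultimately show ?thesis
        using bad_iff_event_trace[OF i] by (simp add: V_def)
    qed
    moreover have "(\<lambda>x\<in>V. rv I x w) = g \<longleftrightarrow> (\<forall>y\<in>V. rv I y w = g y)"
      if "g \<in> event_trace I i" for g w
      using ext[OF that] by (auto simp: extensional_def restrict_def)
    ultimately show ?thesis
      by (auto simp: E_def) metis
  qed
  moreover have "prob (\<Union>g\<in>event_trace I i. E g) = (\<Sum>g\<in>event_trace I i. prob (E g))"
  proof (rule finite_measure_finite_Union)
    show "E ` event_trace I i \<subseteq> events"
      using prob_agree(1)[OF V] event_trace_in_rng[OF i] by (auto simp: E_def V_def)
    show "disjoint_family_on E (event_trace I i)"
      unfolding disjoint_family_on_def
    proof (intro ballI impI)
      fix g g' assume "g \<in> event_trace I i" "g' \<in> event_trace I i" "g \<noteq> g'"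
      \<comment> \<open>Both functions are extensional on \<open>V\<close>, so they must differ
        inside \<open>V\<close>.\<close>
      then obtain y where "y \<in> V" "g y \<noteq> g' y"
        using ext extensionalityI by metis
      then show "E g \<inter> E g' = {}"
        by (auto simp: E_def)
    qed
  qed (rule finite_event_trace[OF i])
  moreover have "prob (E g) = (\<Prod>y\<in>V. measure (law I y) {g y})" if "g \<in> event_trace I i" for g
    unfolding E_def using event_trace_in_rng[OF i that] by (intro prob_agree(2)[OF V]) (simp add: V_def)
  ultimately show ?thesis
    unfolding event_prob_def fixed_prob_def value_prob_def by (simp add: V_def)
qed

section \<open>Averaging over the values of a variable\<close>

lemma value_prob_nonneg: "0 \<le> value_prob I h y a"
  by (simp add: value_prob_def split: option.split)

lemma fixed_prob_nonneg: "0 \<le> fixed_prob I h i"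
  by (auto simp: fixed_prob_def intro!: sum_nonneg prod_nonneg value_prob_nonneg)

lemma share_nonneg: "0 \<le> share I h i j"
  by (auto simp: share_def intro!: prod_nonneg fixed_prob_nonneg divide_nonneg_nonneg)

lemma pair_share_nonneg: "0 \<le> pair_share I h x i"
  by (auto simp: pair_share_def intro!: prod_nonneg share_nonneg)

text \<open>This is the martingale property. After fixing \<open>x\<close> to \<open>c\<close> only
  traces \<open>g\<close> with \<open>g x = c\<close> keep their weight, so each trace is counted
  for exactly one value, which lies in the range. Freshness matters because \<open>map_of\<close>
  returns the first entry for a key.\<close>

lemma sum_fixed_prob_snoc:
  assumes i: "i \<in> lll.events I" and x: "x \<in> event_vars I i" and fresh: "x \<notin> fst ` set h"
  shows "(\<Sum>c\<in>rng I x. measure (law I x) {c} * fixed_prob I (h @ [(x, c)]) i) = fixed_prob I h i"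
proof -
  define V where "V = event_vars I i - {x}"
  have V: "event_vars I i = insert x V" "x \<notin> V" "finite V"
    using x finite_event_vars by (auto simp: V_def)
  have xv: "x \<in> vars I" using x event_vars_subset by auto
  have None: "map_of h x = None" using fresh by (simp add: map_of_eq_None_iff)
  have at: "value_prob I (h @ [(x, c)]) x a = of_bool (a = c)" for a c
    using None by (simp add: value_prob_def map_add_def)
  have off: "value_prob I (h @ [(x, c)]) y a = value_prob I h y a" if "y \<in> V" for y a c
    using that V(2) by (auto simp: value_prob_def map_add_def split: option.split)
  have h: "value_prob I h x a = measure (law I x) {a}" for a
    using None by (simp add: value_prob_def)
  have "(\<Sum>c\<in>rng I x. measure (law I x) {c} * fixed_prob I (h @ [(x, c)]) i)
      = (\<Sum>g\<in>event_trace I i. \<Sum>c\<in>rng I x. measure (law I x) {c} *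
          (of_bool (g x = c) * (\<Prod>y\<in>V. value_prob I h y (g y))))"
    unfolding fixed_prob_def sum_distrib_left
    by (subst sum.swap) (use V at off in simp)
  also have "\<dots> = (\<Sum>g\<in>event_trace I i. measure (law I x) {g x} * (\<Prod>y\<in>V. value_prob I h y (g y)))"
  proof (rule sum.cong[OF refl])
    fix g assume g: "g \<in> event_trace I i"
    have "(\<Sum>c\<in>rng I x. measure (law I x) {c} *
          (of_bool (g x = c) * (\<Prod>y\<in>V. value_prob I h y (g y))))
      = (\<Sum>c\<in>rng I x. if g x = c then measure (law I x) {c} * (\<Prod>y\<in>V. value_prob I h y (g y)) else 0)"
      by (intro sum.cong) auto
    then show "(\<Sum>c\<in>rng I x. measure (law I x) {c} *
          (of_bool (g x = c) * (\<Prod>y\<in>V. value_prob I h y (g y))))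
      = measure (law I x) {g x} * (\<Prod>y\<in>V. value_prob I h y (g y))"
      using finite_rng[OF xv] event_trace_in_rng[OF i g x] by simp
  qed
  also have "\<dots> = fixed_prob I h i"
    unfolding fixed_prob_def using V h by simp
  finally show ?thesis .
qed

lemma fixed_prob_snoc_other:
  assumes "x \<notin> event_vars I i"
  shows "fixed_prob I (h @ [(x, c)]) i = fixed_prob I h i"
  using assms by (intro fixed_prob_cong) (auto simp: map_add_def split: option.split)

text \<open>A mean of nonnegative numbers that is 0 has only zero terms at values of positive mass.
  This lets the new probability be written as the old one times the quotient even where the quotient
  is 0/0.\<close>

lemma fixed_prob_snoc_zero:
  assumes i: "i \<in> lll.events I" and x: "x \<in> event_vars I i" and fresh: "x \<notin> fst ` set h"
    and c: "c \<in> rng I x" "0 < measure (law I x) {c}" and zero: "fixed_prob I h i = 0"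
  shows "fixed_prob I (h @ [(x, c)]) i = 0"
proof -
  have "finite (rng I x)"
    using finite_rng x event_vars_subset by auto
  then have "measure (law I x) {c} * fixed_prob I (h @ [(x, c)]) i = 0"
    using sum_fixed_prob_snoc[OF i x fresh] zero c(1) fixed_prob_nonneg
    by (simp add: sum_nonneg_eq_0_iff)
  then show ?thesis using c by simp
qed

text \<open>If every value of positive mass increased the weighted sum, so would the mean over the
  law of \<open>x\<close>. By linearity that mean is at most the old sum, since each factor has mean
  at most 1.\<close>

lemma ex_good_value:
  assumes x: "x \<in> vars I" and fresh: "x \<notin> fst ` set h"
  shows "\<exists>c. good_value I h x c"
proof (rule ccontr)
  assume none: "\<nexists>c. good_value I h x c"
  define A where "A = affected_events I x"
  define m where "m c = measure (law I x) {c}" for c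
  define r where "r c i = fixed_prob I (h @ [(x, c)]) i / fixed_prob I h i" for c i
  define M where "M = (\<Sum>i\<in>A. pair_share I h x i)"
  have m0: "0 \<le> m c" for c by (simp add: m_def)
  \<comment> \<open>Equality fails when the old probability is 0, as then all quotients are
    0.\<close>
  have mean: "(\<Sum>c\<in>rng I x. m c * r c i) \<le> 1" if "i \<in> A" for i
  proof -
    have "i \<in> lll.events I" "x \<in> event_vars I i"
      using that by (auto simp: A_def affected_events_def event_vars_def affects_def)
    from sum_fixed_prob_snoc[OF this fresh]
    have "(\<Sum>c\<in>rng I x. m c * r c i) = fixed_prob I h i / fixed_prob I h i"
      by (simp add: m_def r_def sum_divide_distrib[symmetric])
    then show ?thesis by simp
  qed
  have large: "M < (\<Sum>i\<in>A. pair_share I h x i * r c i)" if "c \<in> rng I x" "0 < m c" for c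
    using none that by (auto simp: good_value_def M_def A_def r_def m_def not_le)
  obtain c where c: "c \<in> rng I x" "0 < m c"
  proof -
    have "\<exists>c\<in>rng I x. m c \<noteq> 0"
    proof (rule ccontr)
      assume "\<not> ?thesis"
      then show False using sum_law[OF x] by (simp add: m_def)
    qed
    then show ?thesis using that m0 by (metis less_eq_real_def)
  qed
  have "M = (\<Sum>c\<in>rng I x. m c * M)"
    using sum_law[OF x] by (simp add: m_def sum_distrib_right[symmetric])
  \<comment> \<open>Values of mass 0 contribute 0 on both sides; one value of positive mass makes
    the inequality strict.\<close>
  also have "\<dots> < (\<Sum>c\<in>rng I x. m c * (\<Sum>i\<in>A. pair_share I h x i * r c i))"
  proof (rule sum_strict_mono_ex1[OF finite_rng[OF x]])
    show "\<forall>c\<in>rng I x. m c * M \<le> m c * (\<Sum>i\<in>A. pair_share I h x i * r c i)"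
    proof
      fix c assume "c \<in> rng I x"
      then show "m c * M \<le> m c * (\<Sum>i\<in>A. pair_share I h x i * r c i)"
        using large[of c] m0[of c] by (cases "m c = 0") (auto intro!: mult_left_mono)
    qed
    show "\<exists>c\<in>rng I x. m c * M < m c * (\<Sum>i\<in>A. pair_share I h x i * r c i)"
      using c large by (intro bexI[of _ c]) auto
  qed
  also have "\<dots> = (\<Sum>i\<in>A. pair_share I h x i * (\<Sum>c\<in>rng I x. m c * r c i))"
    unfolding sum_distrib_left by (subst sum.swap) (simp add: mult_ac)
  also have "\<dots> \<le> M"
    unfolding M_def using mean pair_share_nonneg
    by (intro sum_mono) (auto intro: mult_left_le)
  finally show False by simp
qed

lemma good_value_share_process:
  "x \<in> vars I \<Longrightarrow> x \<notin> fst ` set h \<Longrightarrow> good_value I h x (share_process I h x)"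
  unfolding share_process_def using ex_good_value by (rule someI_ex)

lemma finite_affected_events: "finite (affected_events I x)"
  using finite_events by (rule rev_finite_subset) (auto simp: affected_events_def affects_def)

lemma affected_events_iff: "i \<in> affected_events I x \<longleftrightarrow> x \<in> event_vars I i"
  by (simp add: affected_events_def event_vars_def)

end

section \<open>The invariant on shares and probabilities\<close>

locale rank2_inst = lll_inst I for I :: "('w, 'v, 'a, 'e) lll" +
  assumes rank2: "x \<in> vars I \<Longrightarrow> card (affected_events I x) \<le> 2"
begin

text \<open>A variable shared by two events affects no third one, so fixing it changes the shares of
  one pair only.\<close>

lemma affected_events_pair:
  assumes "x \<in> event_vars I i" "x \<in> event_vars I j" "i \<noteq> j"
  shows "affected_events I x = {i, j}"
proof -
  have "{i, j} \<subseteq> affected_events I x" using assms by (simp add: affected_events_iff)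
  moreover have "card (affected_events I x) \<le> card {i, j}"
    using rank2[OF subsetD[OF event_vars_subset assms(1)]] assms(3) by simp
  ultimately show ?thesis
    using card_seteq[OF finite_affected_events] by blast
qed

text \<open>The second part is an inequality because a variable affecting \<open>i\<close> alone may
  lower its probability but enters no share of \<open>i\<close> towards another event. The first
  part may range over all pairs: without a common variable both shares are 1.\<close>

definition balanced :: "('v \<times> 'a) list \<Rightarrow> bool" where
  "balanced h \<longleftrightarrow>
     (\<forall>i j. i \<noteq> j \<longrightarrow> share I h i j + share I h j i \<le> 2) \<and>
     (\<forall>i\<in>lll.events I. fixed_prob I h i \<le>
        event_prob I i * (\<Prod>j | j \<in> lll.events I \<and> adjacent I i j. share I h i j))"

lemma balanced_Nil: "balanced []"
  by (simp add: balanced_def share_def fixed_prob_Nil)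

text \<open>The pair sum is controlled by the choice of \<open>c\<close>. The probability of
  \<open>i\<close> and its share towards the other event affected by \<open>x\<close> gain the same
  factor; if there is no other event, the probability does not grow.\<close>

lemma balanced_snoc:
  assumes bal: "balanced h" and fresh: "x \<notin> fst ` set h"
    and c: "good_value I h x c"
  shows "balanced (h @ [(x, c)])"
proof -
  define h' where "h' = h @ [(x, c)]"
  define r where "r i = fixed_prob I h' i / fixed_prob I h i" for i
  have pair: "share I h' i j + share I h' j i \<le> 2" if ij: "i \<noteq> j" for i j
  proof (cases "x \<in> event_vars I i \<inter> event_vars I j")
    case True
    then have A: "affected_events I x = {i, j}"
      using affected_events_pair ij by auto
    have "{i, j} - {i} = {j}" "{i, j} - {j} = {i}" using ij by auto
    \<comment> \<open>For two affected events the criterion on \<open>c\<close> is this inequality,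
      and its left side is the new pair sum.\<close>
    then have "share I h i j * r i + share I h j i * r j \<le> share I h i j + share I h j i"
      using c ij by (simp add: good_value_def A pair_share_def r_def h'_def)
    then show ?thesis
      using bal ij True by (force simp: balanced_def share_snoc h'_def r_def)
  next
    case False
    then have "x \<notin> event_vars I j \<inter> event_vars I i" by auto
    then show ?thesis
      using False bal ij by (simp only: balanced_def share_snoc h'_def if_False mult_1_right) blast
  qed
  have single: "fixed_prob I h' i \<le>
      event_prob I i * (\<Prod>j | j \<in> lll.events I \<and> adjacent I i j. share I h' i j)"
    if i: "i \<in> lll.events I" for i
  proof -
    define N where "N = {j \<in> lll.events I. adjacent I i j}"
    have finN: "finite N" using finite_events by (simp add: N_def)
    have old: "fixed_prob I h i \<le> event_prob I i * (\<Prod>j\<in>N. share I h i j)"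
      using bal i by (simp add: balanced_def N_def)
    consider (none) "x \<notin> event_vars I i" | (one) "affected_events I x = {i}"
      | (two) j where "x \<in> event_vars I i" "x \<in> event_vars I j" "i \<noteq> j"
      by (auto simp: affected_events_iff[symmetric])
    then have "fixed_prob I h' i \<le> event_prob I i * (\<Prod>j\<in>N. share I h' i j)"
    proof cases
      case none
      then show ?thesis
        using old by (simp add: h'_def fixed_prob_snoc_other share_snoc)
    next
      case one
      have xi: "x \<in> event_vars I i"
        using one by (auto simp: affected_events_iff[symmetric])
      \<comment> \<open>With one affected event \<open>pair_share\<close> is an empty product, so
        the criterion bounds the factor itself.\<close>
      have "r i \<le> 1"
        using c by (simp add: good_value_def one pair_share_def r_def h'_def)
      then have "fixed_prob I h' i \<le> fixed_prob I h i"
        using fixed_prob_snoc_zero[OF i xi fresh, of c] c fixed_prob_nonneg[of h i]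
        by (cases "fixed_prob I h i = 0") (auto simp: r_def h'_def good_value_def field_simps)
      moreover have "share I h' i j = share I h i j" if "j \<in> N" for j
      proof -
        have "x \<notin> event_vars I j"
          using one that by (auto simp: affected_events_iff[symmetric] N_def adjacent_def)
        then show ?thesis by (simp add: h'_def share_snoc)
      qed
      ultimately show ?thesis using old by simp
    next
      case (two j)
      have A: "affected_events I x = {i, j}"
        using two by (rule affected_events_pair)
      have j: "j \<in> N"
        using two by (auto simp: N_def adjacent_def event_vars_def affects_def)
      have at: "share I h' i j = share I h i j * r i"
        using two by (simp add: h'_def share_snoc r_def)
      have off: "share I h' i k = share I h i k" if "k \<in> N - {j}" for k
      proof -
        have "x \<notin> event_vars I k"
          using A that by (auto simp: affected_events_iff[symmetric] N_def adjacent_def)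
        then show ?thesis by (simp add: h'_def share_snoc)
      qed
      \<comment> \<open>If the old probability is 0, the new one is 0 too, because \<open>c\<close>
        has positive mass.\<close>
      have "fixed_prob I h' i = fixed_prob I h i * r i"
        using fixed_prob_snoc_zero[OF i two(1) fresh, of c] c
        by (auto simp: r_def h'_def good_value_def)
      also have "\<dots> \<le> (event_prob I i * (\<Prod>j\<in>N. share I h i j)) * r i"
        using old by (rule mult_right_mono) (simp add: r_def fixed_prob_nonneg)
      also have "\<dots> = event_prob I i * (\<Prod>j\<in>N. share I h' i j)"
        using off at by (simp add: prod.remove[OF finN j] mult_ac)
      finally show ?thesis .
    qed
    then show ?thesis by (simp add: N_def)
  qed
  show ?thesis
    using pair single by (simp add: balanced_def h'_def)
qed

section \<open>Runs and the final assignment\<close>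

lemma run_snoc: "run \<sigma> I (xs @ [x]) = run \<sigma> I xs @ [(x, \<sigma> I (run \<sigma> I xs) x)]"
  by (simp add: run_def)

lemma run_share_process:
  assumes "distinct xs" "set xs \<subseteq> vars I"
  shows "map fst (run share_process I xs) = xs \<and> balanced (run share_process I xs) \<and>
    (\<forall>(x, c) \<in> set (run share_process I xs). c \<in> rng I x)"
  using assms
proof (induction xs rule: rev_induct)
  case Nil
  then show ?case by (simp add: run_def balanced_Nil)
next
  case (snoc x xs)
  define h where "h = run share_process I xs"
  have IH: "map fst h = xs" "balanced h" "\<forall>(x, c) \<in> set h. c \<in> rng I x"
    using snoc by (auto simp: h_def)
  have fresh: "x \<notin> fst ` set h"
    using IH(1) snoc.prems by (metis distinct_append disjoint_iff list.set_intros(1) list.set_map)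
  have good: "good_value I h x (share_process I h x)"
    using good_value_share_process snoc.prems fresh by simp
  then have "share_process I h x \<in> rng I x"
    by (simp add: good_value_def)
  then show ?case
    using IH balanced_snoc[OF IH(2) fresh good] by (auto simp: run_snoc h_def[symmetric])
qed

text \<open>The opposite share is nonnegative, so each share is at most the pair sum bound 2, and
  \<open>i\<close> has at most \<open>max_degree I\<close> neighbours.\<close>

lemma fixed_prob_le_balanced:
  assumes bal: "balanced h" and i: "i \<in> lll.events I"
  shows "fixed_prob I h i \<le> event_prob I i * 2 ^ max_degree I"
proof -
  define N where "N = {j \<in> lll.events I. adjacent I i j}"
  have "share I h i j \<le> 2" if "j \<in> N" for j
  proof -
    have "i \<noteq> j" using that by (simp add: N_def adjacent_def)
    then have "share I h i j + share I h j i \<le> 2"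
      using bal by (simp add: balanced_def)
    then show ?thesis using share_nonneg[of h j i] by simp
  qed
  then have "(\<Prod>j\<in>N. share I h i j) \<le> (\<Prod>j\<in>N. 2)"
    by (intro prod_mono) (simp add: share_nonneg)
  also have "\<dots> \<le> 2 ^ max_degree I"
  proof -
    have "card N \<le> max_degree I"
      unfolding max_degree_def N_def using finite_events i by (intro Max_ge) auto
    then show ?thesis by (simp add: power_increasing)
  qed
  finally have "event_prob I i * (\<Prod>j\<in>N. share I h i j) \<le> event_prob I i * 2 ^ max_degree I"
    by (intro mult_left_mono) (auto simp: event_prob_def)
  then show ?thesis
    using bal i by (auto simp: balanced_def N_def intro: order_trans)
qed

text \<open>The trace of \<open>f\<close> contributes a product of point masses at the fixed values,
  all equal to 1, and the other terms are nonnegative.\<close>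

lemma fixed_prob_ge_1:
  assumes i: "i \<in> lll.events I" and f: "f \<in> bad I i"
    and agree: "\<And>y. y \<in> event_vars I i \<Longrightarrow> map_of h y = Some (f y)"
  shows "1 \<le> fixed_prob I h i"
proof -
  define g where "g = restrict f (event_vars I i)"
  have "g \<in> event_trace I i" using f by (auto simp: event_trace_def g_def)
  then have "(\<Prod>y\<in>event_vars I i. value_prob I h y (g y)) \<le> fixed_prob I h i"
    unfolding fixed_prob_def using finite_event_trace[OF i]
    by (intro member_le_sum) (auto intro!: prod_nonneg value_prob_nonneg)
  moreover have "(\<Prod>y\<in>event_vars I i. value_prob I h y (g y)) = 1"
    using agree by (intro prod.neutral) (simp add: value_prob_def g_def)
  ultimately show ?thesis by simp
qed

lemma solves_share_process:
  assumes p: "\<And>i. i \<in> lll.events I \<Longrightarrow> event_prob I i \<le> p"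
    and crit: "p < 2 powr (- real (max_degree I))"
  shows "solves share_process I"
  unfolding solves_def
proof (intro allI impI)
  fix xs assume xs: "distinct xs \<and> set xs = vars I"
  define h where "h = run share_process I xs"
  define f where "f = outcome share_process I xs"
  have h: "map fst h = xs" "balanced h" "\<And>x c. (x, c) \<in> set h \<Longrightarrow> c \<in> rng I x"
    using run_share_process[of xs] xs by (auto simp: h_def)
  \<comment> \<open>Every variable occurs in the run, so \<open>the\<close> is never applied to
    \<open>None\<close>.\<close>
  have agree: "map_of h y = Some (f y)" if "y \<in> vars I" for y
  proof -
    have "y \<in> fst ` set h" using h(1) xs that by (metis list.set_map)
    then have "map_of h y \<noteq> None" by (simp add: map_of_eq_None_iff)
    then show ?thesis using that by (auto simp: f_def outcome_def h_def)
  qed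
  have "f \<in> assignments I"
    using h(3) agree map_of_SomeD unfolding assignments_def
    by (fastforce simp: f_def outcome_def)
  moreover have "f \<notin> bad I i" if i: "i \<in> lll.events I" for i
  proof
    assume "f \<in> bad I i"
    then have "1 \<le> fixed_prob I h i"
      using agree event_vars_subset by (intro fixed_prob_ge_1[OF i]) auto
    also have "\<dots> \<le> event_prob I i * 2 ^ max_degree I"
      using h(2) i by (rule fixed_prob_le_balanced)
    also have "\<dots> \<le> p * 2 ^ max_degree I"
      using p[OF i] by (intro mult_right_mono) auto
    also have "\<dots> < 1"
      using crit by (simp add: powr_minus powr_realpow field_simps)
    finally show False by simp
  qed
  ultimately show "outcome share_process I xs \<in> assignments I \<and>
      (\<forall>i\<in>lll.events I. outcome share_process I xs \<notin> bad I i)"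
    by (simp add: f_def)
qed

end

theorem theorem1:
  "\<exists>\<sigma> :: ('w, 'v, 'a, 'e) lll_process. local_process \<sigma> \<and>
     (\<forall>(I :: ('w, 'v, 'a, 'e) lll) (p :: real).
        lll_instance I \<and>
        (\<forall>x \<in> vars I. card (affected_events I x) \<le> 2) \<and>
        (\<forall>i \<in> events I. event_prob I i \<le> p) \<and>
        p < 2 powr (- real (max_degree I))
        \<longrightarrow> solves \<sigma> I)"
proof (intro exI conjI allI impI)
  show "local_process (share_process :: ('w, 'v, 'a, 'e) lll_process)"
    by (rule local_share_process)
  fix I :: "('w, 'v, 'a, 'e) lll" and p :: real
  assume a: "lll_instance I \<and>
        (\<forall>x \<in> vars I. card (affected_events I x) \<le> 2) \<and>
        (\<forall>i \<in> events I. event_prob I i \<le> p) \<and>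
        p < 2 powr (- real (max_degree I))"
  then interpret rank2_inst I
    by unfold_locales auto
  show "solves share_process I"
    using a by (intro solves_share_process) auto
qed

end
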